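(* Let $q$ be a prime power, $m\ge 1$ an integer, and let $f\in\mathbb{F}_q[x]$ be a monic divisor of $x^m-1$ of degree $n$. For $\alpha\in\mathbb{F}_{q^m}$ let $\eta_f(\alpha)=1$ if the $\mathbb{F}_q$-Order of $\alpha$ is $f$, and $\eta_f(\alpha)=0$ otherwise. Then, for every $\alpha\in\mathbb{F}_{q^m}$, $$\eta_f(\alpha)=\frac{\phi(f)}{q^m}\sum_{h\mid f}\frac{\mu(h)}{\phi(h)}\sum_{\substack{g\mid \frac{x^m-1}{f}\\ \gcd\left(h,\frac{x^m-1}{fg}\right)=1}}\ \sum_{\chi\in X_{hg}}\chi(\alpha),$$ where $h$ and $g$ run over monic divisors in $\mathbb{F}_q[x]$ and $X_{hg}$ is the set of all additive characters of $\mathbb{F}_{q^m}$ of $\mathbb{F}_q$-Order $hg$.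
   Context: For $l(x)=\sum_{i=0}^n a_i x^i\in\mathbb{F}_q[x]$ and $\gamma\in\mathbb{F}_{q^m}$, write $l\circ\gamma=\sum_{i=0}^n a_i\gamma^{q^i}$. The $\mathbb{F}_q$-Order of an element $\gamma\in\mathbb{F}_{q^m}$ is the unique monic polynomial $f\in\mathbb{F}_q[x]$ of least degree with $f\circ\gamma=0$. An additive character of $\mathbb{F}_{q^m}$ is a group homomorphism $\chi:(\mathbb{F}_{q^m},+)\to\mathbb{C}^*$; its $\mathbb{F}_q$-Order is the unique monic polynomial $f\in\mathbb{F}_q[x]$ of least degree such that $\chi(f\circ\gamma)=1$ for all $\gamma\in\mathbb{F}_{q^m}$. For a nonzero $f\in\mathbb{F}_q[x]$: $\phi(f)$ is the number of polynomials in $\mathbb{F}_q[x]$ of degree less than $\deg f$ that are coprime to $f$ (with $\phi(1)=1$); $\mu(f)=(-1)^r$ if $f$ is the product of $r$ distinct irreducible polynomials (with $\mu(1)=1$), and $\mu(f)=0$ otherwise. *)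

theory Defs
  imports Complex_Main "HOL-Library.Cardinality" "HOL-Computational_Algebra.Computational_Algebra"
begin

text \<open>
  The extension of finite fields is given by two types of class \<open>finite_field\<close>, the small field
  \<open>'a\<close> (with \<open>q = CARD('a)\<close> elements) and the large field \<open>'b\<close>, together with an embedding
  \<open>\<iota>\<close> of \<open>'a\<close> into \<open>'b\<close>. Polynomials over the small field are then the library type \<open>'a poly\<close>.
\<close>

definition field_embedding :: "('a::field \<Rightarrow> 'b::field) \<Rightarrow> bool" where
  "field_embedding \<iota> \<longleftrightarrow>
     (\<forall>x y. \<iota> (x + y) = \<iota> x + \<iota> y) \<and> (\<forall>x y. \<iota> (x * y) = \<iota> x * \<iota> y) \<and> \<iota> 1 = 1"

definition frob_act :: "('a::finite_field \<Rightarrow> 'b::finite_field) \<Rightarrow> 'a poly \<Rightarrow> 'b \<Rightarrow> 'b" where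
  "frob_act \<iota> l \<gamma> = (\<Sum>i\<le>degree l. \<iota> (coeff l i) * \<gamma> ^ (CARD('a) ^ i))"

definition is_least_monic :: "('a::field poly \<Rightarrow> bool) \<Rightarrow> 'a poly \<Rightarrow> bool" where
  "is_least_monic P f \<longleftrightarrow>
     lead_coeff f = 1 \<and> P f \<and> (\<forall>g. lead_coeff g = 1 \<and> P g \<longrightarrow> degree f \<le> degree g)"

definition elem_Order :: "('a::finite_field \<Rightarrow> 'b::finite_field) \<Rightarrow> 'b \<Rightarrow> 'a poly" where
  "elem_Order \<iota> \<gamma> = (THE f. is_least_monic (\<lambda>f. frob_act \<iota> f \<gamma> = 0) f)"

definition additive_character :: "('b::finite_field \<Rightarrow> complex) \<Rightarrow> bool" where
  "additive_character \<chi> \<longleftrightarrow> (\<forall>x y. \<chi> (x + y) = \<chi> x * \<chi> y) \<and> (\<forall>x. \<chi> x \<noteq> 0)"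

definition char_Order ::
  "('a::finite_field \<Rightarrow> 'b::finite_field) \<Rightarrow> ('b \<Rightarrow> complex) \<Rightarrow> 'a poly" where
  "char_Order \<iota> \<chi> = (THE f. is_least_monic (\<lambda>f. \<forall>\<gamma>. \<chi> (frob_act \<iota> f \<gamma>) = 1) f)"

definition chars_of_Order ::
  "('a::finite_field \<Rightarrow> 'b::finite_field) \<Rightarrow> 'a poly \<Rightarrow> ('b \<Rightarrow> complex) set" where
  "chars_of_Order \<iota> k = {\<chi>. additive_character \<chi> \<and> char_Order \<iota> \<chi> = k}"

text \<open>
  The zero polynomial counts as having degree less than that of every nonzero \<open>f\<close>, constants
  included, although the library sets \<open>degree 0 = 0\<close>; in particular \<open>poly_phi 1 = 1\<close>.
\<close>
definition poly_phi :: "'a::finite_field poly \<Rightarrow> nat" where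
  "poly_phi f = card {g. (g = 0 \<or> degree g < degree f) \<and> coprime g f}"

text \<open>
  Being a product of distinct irreducibles is understood up to a nonzero constant factor, and
  distinctness up to associates; this is achieved by taking the irreducible factors monic.
\<close>
definition is_irreducible_factor_set :: "'a::field poly \<Rightarrow> 'a poly set \<Rightarrow> bool" where
  "is_irreducible_factor_set f S \<longleftrightarrow>
     finite S \<and> (\<forall>p\<in>S. irreducible p \<and> lead_coeff p = 1) \<and> f = smult (lead_coeff f) (\<Prod>S)"

text \<open>The set \<open>S\<close> below is unique, by \<open>is_irreducible_factor_set_unique\<close>.\<close>
definition poly_mu :: "'a::field poly \<Rightarrow> int" where
  "poly_mu f = (if f \<noteq> 0 \<and> (\<exists>S. is_irreducible_factor_set f S)
                then (- 1) ^ card (THE S. is_irreducible_factor_set f S) else 0)"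

definition eta :: "('a::finite_field \<Rightarrow> 'b::finite_field) \<Rightarrow> 'a poly \<Rightarrow> 'b \<Rightarrow> complex" where
  "eta \<iota> f \<alpha> = (if elem_Order \<iota> \<alpha> = f then 1 else 0)"

definition monic_divisors :: "'a::field poly \<Rightarrow> 'a poly set" where
  "monic_divisors f = {d. lead_coeff d = 1 \<and> d dvd f}"


text \<open>The definite descriptions above are meaningful:\<close>

lemma is_least_monic_ex1:
  fixes P :: "'a::field poly \<Rightarrow> bool"
  assumes diff: "\<And>f g. P f \<Longrightarrow> P g \<Longrightarrow> P (f - g)"
    and smult: "\<And>c f. P f \<Longrightarrow> P (smult c f)"
    and ex: "\<exists>f. f \<noteq> 0 \<and> P f"
  shows "\<exists>!f. is_least_monic P f"
proof -
  have monic: "\<exists>g. lead_coeff g = 1 \<and> P g \<and> degree g = degree f" if "f \<noteq> 0" "P f" for f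
    using that smult[of f "inverse (lead_coeff f)"]
    by (intro exI[of _ "smult (inverse (lead_coeff f)) f"]) auto
  then have "\<exists>f. lead_coeff f = 1 \<and> P f"
    using ex by blast
  then obtain f where f: "lead_coeff f = 1 \<and> P f"
    and min: "\<And>g. lead_coeff g = 1 \<and> P g \<Longrightarrow> degree f \<le> degree g"
    using ex_has_least_nat[of "\<lambda>f. lead_coeff f = 1 \<and> P f" _ degree] by metis
  show ?thesis
  proof (rule ex1I[of _ f])
    show "is_least_monic P f"
      using f min by (auto simp: is_least_monic_def)
    fix g assume g: "is_least_monic P g"
    then have deg: "degree g = degree f"
      using f min by (auto simp: is_least_monic_def intro!: antisym)
    show "g = f"
    proof (rule ccontr)
      assume "g \<noteq> f"
      then have nz: "g - f \<noteq> 0" by simp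
      have "P (g - f)"
        using f g diff by (auto simp: is_least_monic_def)
      then obtain h where h: "lead_coeff h = 1" "P h" "degree h = degree (g - f)"
        using monic[OF nz] by blast
      have "degree f \<le> degree (g - f)"
        using min[of h] h by auto
      moreover have "degree (g - f) \<le> degree f"
        using degree_diff_le[of g "degree f" f] deg by simp
      ultimately have "degree (g - f) = degree f" by simp
      then have "lead_coeff (g - f) = coeff g (degree g) - coeff f (degree f)"
        using deg by simp
      also have "\<dots> = 0"
        using f g by (simp add: is_least_monic_def)
      finally show False using nz by (simp only: leading_coeff_0_iff)
    qed
  qed
qed

context
  fixes \<iota> :: "'a::finite_field \<Rightarrow> 'b::finite_field"
  assumes emb: "field_embedding \<iota>"
begin

lemma embedding_simps: "\<iota> (x + y) = \<iota> x + \<iota> y" "\<iota> (x * y) = \<iota> x * \<iota> y" "\<iota> 1 = 1" "\<iota> 0 = 0"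
  "\<iota> (x - y) = \<iota> x - \<iota> y" "\<iota> (x ^ k) = \<iota> x ^ k"
proof -
  show add: "\<iota> (x + y) = \<iota> x + \<iota> y" for x y
    using emb by (simp add: field_embedding_def)
  show mult: "\<iota> (x * y) = \<iota> x * \<iota> y" for x y
    using emb by (simp add: field_embedding_def)
  show one: "\<iota> 1 = 1"
    using emb by (simp add: field_embedding_def)
  show "\<iota> 0 = 0"
    using add[of 0 0] by (metis add_0_right add_left_cancel)
  show "\<iota> (x - y) = \<iota> x - \<iota> y"
    using add[of "x - y" y] by (simp add: algebra_simps)
  show "\<iota> (x ^ k) = \<iota> x ^ k"
    by (induction k) (simp_all add: one mult)
qed

lemma frob_act_eq_sum:
  assumes "degree l \<le> N"
  shows "frob_act \<iota> l \<gamma> = (\<Sum>i\<le>N. \<iota> (coeff l i) * \<gamma> ^ (CARD('a) ^ i))"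
  unfolding frob_act_def using assms
  by (intro sum.mono_neutral_left) (auto simp: coeff_eq_0 embedding_simps)

lemma frob_act_diff: "frob_act \<iota> (f - g) \<gamma> = frob_act \<iota> f \<gamma> - frob_act \<iota> g \<gamma>"
proof -
  define N where "N = max (degree f) (degree g)"
  have "degree (f - g) \<le> N" "degree f \<le> N" "degree g \<le> N"
    unfolding N_def by (auto intro: degree_diff_le_max)
  then show ?thesis
    by (simp add: frob_act_eq_sum embedding_simps sum_subtractf algebra_simps)
qed

lemma frob_act_smult: "frob_act \<iota> (smult c f) \<gamma> = \<iota> c * frob_act \<iota> f \<gamma>"
  unfolding frob_act_eq_sum[OF degree_smult_le] frob_act_def
  by (simp add: embedding_simps sum_distrib_left mult.assoc)

lemma frob_act_scale: "frob_act \<iota> f (\<iota> c * \<gamma>) = \<iota> c * frob_act \<iota> f \<gamma>"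
proof -
  have "\<iota> c ^ (CARD('a) ^ i) = \<iota> c" for i
    using finite_field_power_card_power_eq_same[OF refl, of c i] embedding_simps(6) by metis
  then show ?thesis
    by (simp add: frob_act_def sum_distrib_left power_mult_distrib mult_ac)
qed

lemma frob_act_annihilator: "\<exists>f. f \<noteq> 0 \<and> (\<forall>\<gamma>. frob_act \<iota> f \<gamma> = 0)"
proof -
  have "infinite (UNIV :: 'a poly set)"
  proof
    assume "finite (UNIV :: 'a poly set)"
    then have "finite (range (\<lambda>n. monom (1::'a) n))"
      by (rule finite_subset[OF subset_UNIV])
    moreover have "inj (\<lambda>n. monom (1::'a) n)"
      by (simp add: inj_def monom_eq_iff')
    ultimately show False
      using finite_imageD[of "\<lambda>n. monom (1::'a) n" UNIV] by simp
  qed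
  moreover have "finite (range (frob_act \<iota>))"
    by (rule finite)
  ultimately have "\<not> inj (frob_act \<iota>)"
    using finite_imageD[of "frob_act \<iota>" UNIV] by auto
  then obtain f g where "f \<noteq> g" "frob_act \<iota> f = frob_act \<iota> g"
    by (auto simp: inj_def)
  then show ?thesis
    by (intro exI[of _ "f - g"]) (auto simp: frob_act_diff)
qed

lemma elem_Order_welldefined: "is_least_monic (\<lambda>f. frob_act \<iota> f \<gamma> = 0) (elem_Order \<iota> \<gamma>)"
proof -
  have "\<exists>!f. is_least_monic (\<lambda>f. frob_act \<iota> f \<gamma> = 0) f"
    by (rule is_least_monic_ex1)
      (use frob_act_annihilator in \<open>auto simp: frob_act_diff frob_act_smult\<close>)
  then show ?thesis
    unfolding elem_Order_def by (rule theI')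
qed

lemma char_Order_welldefined:
  assumes "additive_character \<chi>"
  shows "is_least_monic (\<lambda>f. \<forall>\<gamma>. \<chi> (frob_act \<iota> f \<gamma>) = 1) (char_Order \<iota> \<chi>)"
proof -
  have add: "\<chi> (x + y) = \<chi> x * \<chi> y" and nz: "\<chi> x \<noteq> 0" for x y
    using assms by (auto simp: additive_character_def)
  have zero: "\<chi> 0 = 1"
    using add[of 0 0] nz[of 0] by simp
  have diff: "\<chi> (x - y) = 1" if "\<chi> x = 1" "\<chi> y = 1" for x y
    using add[of "x - y" y] that by simp
  have "\<exists>!f. is_least_monic (\<lambda>f. \<forall>\<gamma>. \<chi> (frob_act \<iota> f \<gamma>) = 1) f"
  proof (rule is_least_monic_ex1)
    fix f g assume "\<forall>\<gamma>. \<chi> (frob_act \<iota> f \<gamma>) = 1" "\<forall>\<gamma>. \<chi> (frob_act \<iota> g \<gamma>) = 1"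
    then show "\<forall>\<gamma>. \<chi> (frob_act \<iota> (f - g) \<gamma>) = 1"
      by (simp add: frob_act_diff diff)
  next
    fix c f assume "\<forall>\<gamma>. \<chi> (frob_act \<iota> f \<gamma>) = 1"
    then show "\<forall>\<gamma>. \<chi> (frob_act \<iota> (smult c f) \<gamma>) = 1"
      by (simp add: frob_act_smult flip: frob_act_scale)
  next
    show "\<exists>f. f \<noteq> 0 \<and> (\<forall>\<gamma>. \<chi> (frob_act \<iota> f \<gamma>) = 1)"
      using frob_act_annihilator zero by metis
  qed
  then show ?thesis
    unfolding char_Order_def by (rule theI')
qed

end

lemma is_irreducible_factor_set_unique:
  fixes f :: "'a::field poly"
  assumes "f \<noteq> 0" "is_irreducible_factor_set f S"
  shows "S = {p. irreducible p \<and> lead_coeff p = 1 \<and> p dvd f}"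
proof (intro equalityI subsetI CollectI)
  have fin: "finite S" and irr: "\<And>p. p \<in> S \<Longrightarrow> irreducible p \<and> lead_coeff p = 1"
    and f: "f = smult (lead_coeff f) (\<Prod>S)"
    using assms by (auto simp: is_irreducible_factor_set_def)
  fix p
  { assume p: "p \<in> S"
    have "p dvd \<Prod>S"
      using fin p by (rule dvd_prodI[of S p "\<lambda>x. x", simplified])
    then show "irreducible p \<and> lead_coeff p = 1 \<and> p dvd f"
      using irr[OF p] f by (metis dvd_smult) }
  assume "p \<in> {p. irreducible p \<and> lead_coeff p = 1 \<and> p dvd f}"
  then have p: "irreducible p" "lead_coeff p = 1" "p dvd f" by auto
  then have "p dvd \<Prod>S"
    using f assms(1) by (metis dvd_smult_cancel leading_coeff_0_iff)
  moreover have "prime_elem p"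
    using p(1) by (rule field_poly_irreducible_imp_prime)
  ultimately obtain r where r: "r \<in> S" "p dvd r"
    using prime_elem_dvd_prod_msetE[of p "mset_set S"] fin by (auto simp: prod_unfold_prod_mset)
  then obtain c where c: "r = p * c" by (elim dvdE)
  then have "is_unit c"
    using irr[OF r(1)] p(1) by (metis irreducibleD irreducible_not_unit)
  then obtain a where "c = [:a:]"
    by (auto simp: is_unit_poly_iff)
  then have "r = smult a p" using c by (simp add: mult.commute)
  moreover from this have "a = 1"
    using irr[OF r(1)] p(2) by (cases "a = 0") auto
  ultimately show "p \<in> S" using r(1) by simp
qed

end

theory Submission
  imports Defs
begin

text \<open>
  Let \<open>F = x\<^sup>m - 1 = f k\<close>, let \<open>a\<close> be the Order of \<open>\<alpha>\<close>, and write \<open>\<bar>d\<bar>\<close> for the number of residues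
  modulo \<open>d\<close>.

  For a divisor \<open>d\<close> of \<open>F\<close>, the characters whose Order divides \<open>d\<close> are those trivial on the image of
  \<open>d\<close>, seen as an additive map on the large field.  Counting roots of linearized polynomials shows that
  this image is the kernel of \<open>F / d\<close>.  Hence, by orthogonality, the sum of \<open>\<chi>(\<alpha>)\<close> over these characters
  is \<open>\<bar>d\<bar>\<close> if \<open>a d\<close> divides \<open>F\<close>, and \<open>0\<close> otherwise (\<open>sum_characters_Order_dvd\<close>).  Orthogonality needs
  enough characters; these come from maximal subgroups (\<open>separating_character\<close>).

  In the formula to be proved, the products \<open>h g\<close> for fixed \<open>h\<close> are the monic divisors of \<open>h k\<close> with
  cofactor coprime to \<open>h\<close>.  Moebius inversion over the divisors \<open>t\<close> of \<open>h\<close> therefore expresses the sum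
  over \<open>g\<close> by the sums over characters of Order dividing \<open>(h / t) k\<close>
  (\<open>sum_chars_of_Order_coprime\<close>), each of which is \<open>\<bar>h / t\<bar> \<bar>k\<bar>\<close> or \<open>0\<close> according to whether
  \<open>a (h / t)\<close> divides \<open>f\<close>.  If \<open>a\<close> does not divide \<open>f\<close>, everything vanishes.  If \<open>f = a r\<close>, the sum
  over \<open>g\<close> is \<open>\<bar>k\<bar>\<close> times the Ramanujan sum of \<open>h\<close> at \<open>r\<close>.  The remaining sum over \<open>h\<close> is an Euler
  product over the primes dividing \<open>f\<close>, which vanishes unless \<open>r = 1\<close> and is then \<open>\<bar>f\<bar> / \<phi>(f)\<close>
  (\<open>sum_ramanujan_eq_indicator\<close>).
\<close>

section \<open>Monic divisors and residues\<close>

lemma card_polys_below: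
  "finite {g::'a::finite_field poly. g = 0 \<or> degree g < n} \<and>
   card {g::'a poly. g = 0 \<or> degree g < n} = CARD('a) ^ n"
proof (induction n)
  case (Suc n)
  let ?B = "\<lambda>n. {g::'a poly. g = 0 \<or> degree g < n}"
  have eq: "?B (Suc n) = (\<lambda>(a, p). pCons a p) ` (UNIV \<times> ?B n)"
  proof (intro equalityI subsetI)
    fix g assume g: "g \<in> ?B (Suc n)"
    obtain a p where ap: "g = pCons a p" by (rule pCons_cases)
    have "p \<in> ?B n" using g by (auto simp: ap split: if_splits)
    then show "g \<in> (\<lambda>(a, p). pCons a p) ` (UNIV \<times> ?B n)" using ap by auto
  qed (auto simp: degree_pCons_eq_if split: if_splits)
  have inj: "inj_on (\<lambda>(a, p). pCons a p) (UNIV \<times> ?B n)"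
    by (auto simp: inj_on_def)
  show ?case
    unfolding eq card_image[OF inj] using Suc by (simp add: card_cartesian_product)
qed simp

lemma finite_monic_divisors:
  fixes h :: "'a::finite_field poly"
  assumes "h \<noteq> 0"
  shows "finite (monic_divisors h)"
proof (rule finite_subset)
  show "monic_divisors h \<subseteq> {g. g = 0 \<or> degree g < Suc (degree h)}"
    using dvd_imp_degree_le[OF _ assms] by (auto simp: monic_divisors_def less_Suc_eq_le)
qed (use card_polys_below in blast)

text \<open>The number of residues modulo \<open>f\<close>, as a complex number; below it is written \<open>\<bar>f\<bar>\<close>.\<close>
definition poly_norm :: "'a::finite_field poly \<Rightarrow> complex" where
  "poly_norm f = of_nat (CARD('a) ^ degree f)"

lemma poly_norm_nonzero [simp]: "poly_norm f \<noteq> 0"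
  by (simp add: poly_norm_def)

lemma poly_norm_1 [simp]: "poly_norm 1 = 1"
  by (simp add: poly_norm_def)

lemma poly_norm_mult: "f \<noteq> 0 \<Longrightarrow> g \<noteq> 0 \<Longrightarrow> poly_norm (f * g) = poly_norm f * poly_norm g"
  by (simp add: poly_norm_def degree_mult_eq power_add)

lemma poly_norm_prod:
  assumes "finite A" "\<And>p. p \<in> A \<Longrightarrow> p \<noteq> 0"
  shows "poly_norm (\<Prod>A) = (\<Prod>p\<in>A. poly_norm p)"
  using assms by (induction A) (simp_all add: poly_norm_mult)

text \<open>
  The multiples of \<open>t\<close> among the residues modulo \<open>f\<close> are \<open>t\<close> times the residues modulo \<open>f / t\<close>.
\<close>
lemma card_multiples_below:
  fixes t f :: "'a::finite_field poly"
  assumes "t dvd f" "f \<noteq> 0"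
  shows "of_nat (card {u. (u = 0 \<or> degree u < degree f) \<and> t dvd u}) = poly_norm f / poly_norm t"
proof -
  obtain k where k: "f = t * k" using assms(1) by (elim dvdE)
  then have nz: "t \<noteq> 0" "k \<noteq> 0" using assms by auto
  have "{u. (u = 0 \<or> degree u < degree f) \<and> t dvd u} = (\<lambda>v. t * v) ` {v. v = 0 \<or> degree v < degree k}"
  proof (intro equalityI subsetI)
    fix u assume u: "u \<in> {u. (u = 0 \<or> degree u < degree f) \<and> t dvd u}"
    then obtain v where "u = t * v" by (auto elim: dvdE)
    moreover from this have "v = 0 \<or> degree v < degree k"
      using u nz by (cases "v = 0") (auto simp: k degree_mult_eq)
    ultimately show "u \<in> (\<lambda>v. t * v) ` {v. v = 0 \<or> degree v < degree k}" by auto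
  next
    fix u assume "u \<in> (\<lambda>v. t * v) ` {v. v = 0 \<or> degree v < degree k}"
    then obtain v where v: "u = t * v" "v = 0 \<or> degree v < degree k" by auto
    then show "u \<in> {u. (u = 0 \<or> degree u < degree f) \<and> t dvd u}"
      using nz by (cases "v = 0") (auto simp: k degree_mult_eq)
  qed
  moreover have "inj_on (\<lambda>v. t * v) {v. v = 0 \<or> degree v < degree k}"
    using nz by (auto simp: inj_on_def)
  ultimately have "card {u. (u = 0 \<or> degree u < degree f) \<and> t dvd u} = CARD('a) ^ degree k"
    using card_polys_below[where 'a = 'a and n = "degree k"] by (simp add: card_image)
  then show ?thesis
    using nz by (simp add: k poly_norm_mult) (simp add: poly_norm_def)
qed

section \<open>Moebius sums as Euler products\<close>

definition monic_prime_factors :: "'a::field poly \<Rightarrow> 'a poly set" where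
  "monic_prime_factors f = {p. irreducible p \<and> lead_coeff p = 1 \<and> p dvd f}"

lemma finite_monic_prime_factors:
  fixes f :: "'a::finite_field poly"
  shows "f \<noteq> 0 \<Longrightarrow> finite (monic_prime_factors f)"
  by (rule finite_subset[OF _ finite_monic_divisors]) (auto simp: monic_prime_factors_def monic_divisors_def)

lemma lead_coeff_prod_monic:
  fixes A :: "'a::field poly set"
  assumes "\<And>p. p \<in> A \<Longrightarrow> lead_coeff p = 1"
  shows "lead_coeff (\<Prod>A) = 1"
  using assms by (simp add: lead_coeff_prod)

lemma monic_prime_dvd_prod_iff:
  fixes p :: "'a::field poly"
  assumes "finite A" "\<And>r. r \<in> A \<Longrightarrow> irreducible r \<and> lead_coeff r = 1"
    and "irreducible p" "lead_coeff p = 1"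
  shows "p dvd \<Prod>A \<longleftrightarrow> p \<in> A"
proof -
  have "is_irreducible_factor_set (\<Prod>A) A" "\<Prod>A \<noteq> 0"
    using assms assms(2)[of 0] lead_coeff_prod_monic[of A] by (auto simp: is_irreducible_factor_set_def)
  then show ?thesis
    using is_irreducible_factor_set_unique[of "\<Prod>A" A] assms(3,4) by blast
qed

text \<open>
  Distinct monic irreducibles are prime and pairwise non-associated, so each new one divides the
  cofactor left by the others.
\<close>
lemma prod_monic_primes_dvd_iff:
  fixes f :: "'a::field poly"
  assumes "finite A" "\<And>p. p \<in> A \<Longrightarrow> irreducible p \<and> lead_coeff p = 1"
  shows "\<Prod>A dvd f \<longleftrightarrow> (\<forall>p\<in>A. p dvd f)"
proof
  assume "\<forall>p\<in>A. p dvd f"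
  with assms show "\<Prod>A dvd f"
  proof (induction A)
    case (insert p A)
    then obtain c where c: "f = \<Prod>A * c" by (auto elim: dvdE)
    have "prime_elem p" using insert.prems by (intro field_poly_irreducible_imp_prime) auto
    moreover have "\<not> p dvd \<Prod>A"
      using insert monic_prime_dvd_prod_iff[of A p] by auto
    moreover have "p dvd \<Prod>A * c" using insert.prems c by auto
    ultimately have "p dvd c" by (simp add: prime_elem_dvd_mult_iff)
    then have "p * \<Prod>A dvd f" by (simp add: c mult.commute mult_dvd_mono)
    then show ?case using insert by simp
  qed simp
next
  assume "\<Prod>A dvd f"
  then show "\<forall>p\<in>A. p dvd f"
    using assms monic_prime_dvd_prod_iff[of A] by (meson dvd_trans)
qed

lemma of_bool_prod_monic_primes_dvd:
  fixes f :: "'a::field poly"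
  assumes "finite A" "\<And>p. p \<in> A \<Longrightarrow> irreducible p \<and> lead_coeff p = 1"
  shows "of_bool (\<Prod>A dvd f) = (\<Prod>p\<in>A. of_bool (p dvd f) :: complex)"
proof -
  have "of_bool (\<forall>p\<in>A. p dvd f) = (\<Prod>p\<in>A. of_bool (p dvd f) :: complex)"
    using assms(1) by (induction A) auto
  then show ?thesis by (simp only: prod_monic_primes_dvd_iff[OF assms])
qed

lemma monic_prime_factors_prod:
  fixes A :: "'a::field poly set"
  assumes "finite A" "\<And>p. p \<in> A \<Longrightarrow> irreducible p \<and> lead_coeff p = 1"
  shows "monic_prime_factors (\<Prod>A) = A"
  using monic_prime_dvd_prod_iff[OF assms] assms(2) by (auto simp: monic_prime_factors_def)

lemma poly_mu_prod:
  fixes A :: "'a::field poly set"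
  assumes "finite A" "\<And>p. p \<in> A \<Longrightarrow> irreducible p \<and> lead_coeff p = 1"
  shows "poly_mu (\<Prod>A) = (- 1) ^ card A"
proof -
  have S: "is_irreducible_factor_set (\<Prod>A) A" "\<Prod>A \<noteq> 0"
    using assms assms(2)[of 0] lead_coeff_prod_monic[of A] by (auto simp: is_irreducible_factor_set_def)
  then have "(THE S. is_irreducible_factor_set (\<Prod>A) S) = A"
    using is_irreducible_factor_set_unique[of "\<Prod>A"] by (intro the_equality) auto
  then show ?thesis using S by (auto simp: poly_mu_def)
qed

text \<open>
  Only squarefree divisors contribute to a Moebius sum, and these correspond to the sets of monic
  irreducible divisors.
\<close>
lemma sum_poly_mu_monic_divisors:
  fixes h :: "'a::finite_field poly" and G :: "'a poly \<Rightarrow> complex"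
  assumes "h \<noteq> 0"
  shows "(\<Sum>t\<in>monic_divisors h. of_int (poly_mu t) * G t) =
    (\<Sum>A\<in>Pow (monic_prime_factors h). (- 1) ^ card A * G (\<Prod>A))"
proof -
  let ?P = "monic_prime_factors h"
  have finP: "finite ?P" using assms by (rule finite_monic_prime_factors)
  have A: "finite A" "\<And>p. p \<in> A \<Longrightarrow> irreducible p \<and> lead_coeff p = 1" if "A \<in> Pow ?P" for A
    using that finP by (auto simp: monic_prime_factors_def intro: finite_subset)
  have inj: "inj_on Prod (Pow ?P)"
    using monic_prime_factors_prod[OF A] by (intro inj_on_inverseI)
  have "(\<Sum>A\<in>Pow ?P. (- 1) ^ card A * G (\<Prod>A)) = (\<Sum>A\<in>Pow ?P. of_int (poly_mu (\<Prod>A)) * G (\<Prod>A))"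
    by (intro sum.cong refl) (simp add: poly_mu_prod[OF A])
  also have "\<dots> = (\<Sum>t\<in>Prod ` Pow ?P. of_int (poly_mu t) * G t)"
    by (simp add: sum.reindex[OF inj])
  also have "\<dots> = (\<Sum>t\<in>monic_divisors h. of_int (poly_mu t) * G t)"
  proof (intro sum.mono_neutral_left ballI)
    show "Prod ` Pow ?P \<subseteq> monic_divisors h"
    proof
      fix t assume "t \<in> Prod ` Pow ?P"
      then obtain B where B: "B \<in> Pow ?P" "t = \<Prod>B" by auto
      have "\<Prod>B dvd h" using prod_monic_primes_dvd_iff[OF A[OF B(1)]] B by (auto simp: monic_prime_factors_def)
      then show "t \<in> monic_divisors h"
        using A[OF B(1)] B(2) lead_coeff_prod_monic[of B] by (auto simp: monic_divisors_def)
    qed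
    fix t assume t: "t \<in> monic_divisors h - Prod ` Pow ?P"
    have "\<not> is_irreducible_factor_set t S" for S
    proof
      assume S: "is_irreducible_factor_set t S"
      then have "t = \<Prod>S" using t by (auto simp: monic_divisors_def is_irreducible_factor_set_def)
      moreover have "S \<subseteq> ?P"
      proof
        fix p assume "p \<in> S"
        moreover have "t \<noteq> 0" using t by (auto simp: monic_divisors_def)
        ultimately have "irreducible p \<and> lead_coeff p = 1 \<and> p dvd t"
          using is_irreducible_factor_set_unique[OF _ S] by blast
        then show "p \<in> ?P" using t dvd_trans[of p t h] by (auto simp: monic_divisors_def monic_prime_factors_def)
      qed
      ultimately show False using t by auto
    qed
    then show "of_int (poly_mu t) * G t = 0" by (simp add: poly_mu_def)
  qed (use assms finite_monic_divisors in auto)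
  finally show ?thesis by simp
qed

text \<open>
  Expanding the product over the primes gives one term per squarefree divisor, so multiplicativity of
  \<open>G\<close> is needed on products of distinct primes only.
\<close>
lemma mobius_euler_product:
  fixes h :: "'a::finite_field poly" and G g :: "'a poly \<Rightarrow> complex"
  assumes "h \<noteq> 0" and "\<And>A. A \<subseteq> monic_prime_factors h \<Longrightarrow> G (\<Prod>A) = (\<Prod>p\<in>A. g p)"
  shows "(\<Sum>t\<in>monic_divisors h. of_int (poly_mu t) * G t) = (\<Prod>p\<in>monic_prime_factors h. 1 - g p)"
  unfolding sum_poly_mu_monic_divisors[OF assms(1)]
    prod_diff_conv_sum[OF finite_monic_prime_factors[OF assms(1)]]
  by (intro sum.cong refl) (simp add: assms(2))

text \<open>A nonunit divisor of least degree is irreducible.\<close>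
lemma monic_prime_factor_exists:
  fixes d :: "'a::field poly"
  assumes "d \<noteq> 0" "\<not> is_unit d"
  shows "\<exists>p. irreducible p \<and> lead_coeff p = 1 \<and> p dvd d"
proof -
  obtain p where p: "p dvd d" "\<not> is_unit p"
    and min: "\<And>r. r dvd d \<Longrightarrow> \<not> is_unit r \<Longrightarrow> degree p \<le> degree r"
    using ex_has_least_nat[of "\<lambda>r. r dvd d \<and> \<not> is_unit r" d degree] assms(2) by auto
  have nz: "p \<noteq> 0" using p assms(1) by auto
  have unit: "is_unit r \<longleftrightarrow> degree r = 0" if "r \<noteq> 0" for r :: "'a poly"
    using that by (simp add: is_unit_iff_degree)
  have "irreducible p"
  proof (rule irreducibleI)
    fix a b assume ab: "p = a * b"
    show "is_unit a \<or> is_unit b"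
    proof (rule ccontr)
      assume c: "\<not> (is_unit a \<or> is_unit b)"
      then have "degree p \<le> degree a" "degree p \<le> degree b"
        using min[of a] min[of b] p(1) ab by (auto intro: dvd_trans)
      then show False
        using ab c nz unit by (auto simp: degree_mult_eq)
    qed
  qed (use nz p in auto)
  moreover define c where "c = inverse (lead_coeff p)"
  moreover have "c \<noteq> 0" using nz by (simp add: c_def)
  ultimately have "irreducible ([:c:] * p)" by (subst irreducible_mult_unit_left) (auto simp: is_unit_const_poly_iff dvd_field_iff)
  then have "irreducible (smult c p)" by simp
  moreover have "lead_coeff (smult c p) = 1" "smult c p dvd d"
    using nz p(1) \<open>c \<noteq> 0\<close> by (auto simp: smult_dvd_iff c_def)
  ultimately show ?thesis by blast
qed

text \<open>
  The Euler product is empty exactly when no monic irreducible divides both \<open>h\<close> and \<open>x\<close>; otherwise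
  one of its factors vanishes.
\<close>
lemma coprime_indicator:
  fixes h x :: "'a::finite_field poly"
  assumes "h \<noteq> 0"
  shows "(\<Sum>t\<in>monic_divisors h. of_int (poly_mu t) * of_bool (t dvd x)) =
    (of_bool (coprime h x) :: complex)"
proof -
  let ?P = "monic_prime_factors h"
  have finP: "finite ?P" using assms by (rule finite_monic_prime_factors)
  have "(\<Sum>t\<in>monic_divisors h. of_int (poly_mu t) * of_bool (t dvd x)) =
      (\<Prod>p\<in>?P. 1 - of_bool (p dvd x) :: complex)"
  proof (rule mobius_euler_product[OF assms])
    fix A assume "A \<subseteq> ?P"
    then have A: "finite A" "\<And>p. p \<in> A \<Longrightarrow> irreducible p \<and> lead_coeff p = 1"
      using finP by (auto simp: monic_prime_factors_def intro: finite_subset)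
    then show "of_bool (\<Prod>A dvd x) = (\<Prod>p\<in>A. of_bool (p dvd x) :: complex)"
      by (rule of_bool_prod_monic_primes_dvd)
  qed
  also have "\<dots> = of_bool (\<forall>p\<in>?P. \<not> p dvd x)"
    using finP by (auto simp: of_bool_def)
  also have "(\<forall>p\<in>?P. \<not> p dvd x) \<longleftrightarrow> coprime h x"
  proof
    assume no: "\<forall>p\<in>?P. \<not> p dvd x"
    show "coprime h x"
    proof (rule coprimeI, rule ccontr)
      fix d assume d: "d dvd h" "d dvd x" "\<not> is_unit d"
      then obtain p where "irreducible p" "lead_coeff p = 1" "p dvd d"
        using monic_prime_factor_exists[of d] assms by (metis dvd_0_left)
      then show False using no d by (auto simp: monic_prime_factors_def dest: dvd_trans)
    qed
  qed (auto simp: monic_prime_factors_def dest: coprime_common_divisor irreducible_not_unit)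
  finally show ?thesis .
qed

text \<open>
  The residues coprime to \<open>f\<close> are counted by inclusion-exclusion: the Moebius indicator of coprimality
  is summed over all residues, \<open>\<bar>f\<bar> / \<bar>t\<bar>\<close> of which are multiples of \<open>t\<close>.
\<close>
lemma poly_phi_euler_product:
  fixes f :: "'a::finite_field poly"
  assumes "f \<noteq> 0"
  shows "of_nat (poly_phi f) = poly_norm f * (\<Prod>p\<in>monic_prime_factors f. 1 - 1 / poly_norm p)"
proof -
  let ?B = "{u::'a poly. u = 0 \<or> degree u < degree f}"
  have fin: "finite ?B" using card_polys_below by blast
  have "(of_nat (poly_phi f) :: complex) = (\<Sum>u\<in>?B. of_bool (coprime f u))"
  proof -
    have "?B \<inter> {u. coprime f u} = {u. (u = 0 \<or> degree u < degree f) \<and> coprime u f}"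
      by (auto simp: coprime_commute)
    then show ?thesis using fin by (simp add: poly_phi_def sum_of_bool_eq)
  qed
  also have "\<dots> = (\<Sum>u\<in>?B. \<Sum>t\<in>monic_divisors f. of_int (poly_mu t) * of_bool (t dvd u))"
    by (simp only: coprime_indicator[OF assms])
  also have "\<dots> = (\<Sum>t\<in>monic_divisors f. of_int (poly_mu t) * (\<Sum>u\<in>?B. of_bool (t dvd u)))"
    by (subst sum.swap) (simp only: sum_distrib_left)
  also have "\<dots> = (\<Sum>t\<in>monic_divisors f. of_int (poly_mu t) * (poly_norm f / poly_norm t))"
  proof (intro sum.cong refl)
    fix t assume "t \<in> monic_divisors f"
    then have "of_nat (card {u. (u = 0 \<or> degree u < degree f) \<and> t dvd u}) = poly_norm f / poly_norm t"
      using assms by (intro card_multiples_below) (auto simp: monic_divisors_def)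
    moreover have "?B \<inter> {u. t dvd u} = {u. (u = 0 \<or> degree u < degree f) \<and> t dvd u}" by auto
    ultimately show "of_int (poly_mu t) * (\<Sum>u\<in>?B. of_bool (t dvd u)) =
        of_int (poly_mu t) * (poly_norm f / poly_norm t)"
      using fin by (simp add: sum_of_bool_eq)
  qed
  also have "\<dots> = poly_norm f * (\<Sum>t\<in>monic_divisors f. of_int (poly_mu t) * (1 / poly_norm t))"
    by (simp add: sum_distrib_left mult_ac)
  also have "(\<Sum>t\<in>monic_divisors f. of_int (poly_mu t) * (1 / poly_norm t)) =
      (\<Prod>p\<in>monic_prime_factors f. 1 - 1 / poly_norm p)"
  proof (rule mobius_euler_product[OF assms])
    fix A assume "A \<subseteq> monic_prime_factors f"
    moreover from this have "finite A" using finite_monic_prime_factors[OF assms] by (rule finite_subset)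
    ultimately show "1 / poly_norm (\<Prod>A) = (\<Prod>p\<in>A. 1 / poly_norm p)"
      by (subst poly_norm_prod) (auto simp: monic_prime_factors_def prod_dividef)
  qed
  finally show ?thesis .
qed

lemma card_field_gt_1: "1 < CARD('a::finite_field)"
proof -
  have "card {0, 1 :: 'a} \<le> CARD('a)" by (intro card_mono) auto
  then show ?thesis by simp
qed

lemma poly_norm_irreducible_neq_1:
  fixes p :: "'a::finite_field poly"
  assumes "irreducible p"
  shows "poly_norm p \<noteq> 1"
proof -
  have "p \<noteq> 0" using assms by auto
  then have "degree p > 0" using assms is_unit_iff_degree[of p] irreducible_not_unit[of p] by auto
  moreover have "1 < CARD('a)" by (rule card_field_gt_1)
  ultimately have "1 < CARD('a) ^ degree p" by (rule one_less_power[rotated])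
  then show ?thesis unfolding poly_norm_def by (metis of_nat_1 of_nat_eq_iff less_irrefl)
qed

text \<open>
  For squarefree \<open>h\<close> the inner sum is the Ramanujan sum of \<open>h\<close> at \<open>r\<close>, whose factor at a prime \<open>p\<close>
  is \<open>\<bar>p\<bar> - 1\<close> or \<open>- 1\<close> according to whether \<open>p\<close> divides \<open>r\<close>.  After division by \<open>\<phi>(h)\<close> the
  Euler factor at \<open>p\<close> of the whole sum is therefore \<open>0\<close> when \<open>p\<close> divides \<open>r\<close>, and the inverse of
  the Euler factor of \<open>\<phi>(f)\<close> otherwise.  As \<open>r\<close> divides \<open>f\<close>, only \<open>r = 1\<close> has no vanishing factor.
\<close>
lemma sum_ramanujan_eq_indicator:
  fixes f r :: "'a::finite_field poly"
  assumes f: "f \<noteq> 0" and r: "lead_coeff r = 1" "r dvd f"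
  shows "of_nat (poly_phi f) / poly_norm f *
    (\<Sum>h\<in>monic_divisors f. of_int (poly_mu h) / of_nat (poly_phi h) *
      (\<Sum>t\<in>monic_divisors h. of_int (poly_mu t) * (poly_norm (h div t) * of_bool (h div t dvd r)))) =
    of_bool (r = 1)"
proof -
  let ?P = "monic_prime_factors f"
  let ?c = "\<lambda>h. \<Sum>t\<in>monic_divisors h. of_int (poly_mu t) * (poly_norm (h div t) * of_bool (h div t dvd r))"
  let ?e = "\<lambda>p. (poly_norm p * of_bool (p dvd r) - 1) / (poly_norm p - 1)"
  have finP: "finite ?P" using f by (rule finite_monic_prime_factors)
  have A: "finite A" "\<And>p. p \<in> A \<Longrightarrow> irreducible p \<and> lead_coeff p = 1" if "A \<subseteq> ?P" for A
    using that finP by (auto simp: monic_prime_factors_def intro: finite_subset)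
  have N1: "poly_norm p - 1 \<noteq> 0" if "p \<in> ?P" for p
    using that poly_norm_irreducible_neq_1[of p] by (auto simp: monic_prime_factors_def)
  have ratio: "?c (\<Prod>A) / of_nat (poly_phi (\<Prod>A)) = (\<Prod>p\<in>A. ?e p)" if AP: "A \<subseteq> ?P" for A
  proof -
    have nz: "\<Prod>B \<noteq> 0" if "B \<subseteq> A" for B
      using lead_coeff_prod_monic[of B] A(2)[OF AP] that by fastforce
    have factor: "poly_norm (\<Prod>A div \<Prod>B) * of_bool (\<Prod>A div \<Prod>B dvd r) =
        (\<Prod>p\<in>A-B. poly_norm p * of_bool (p dvd r))" if BA: "B \<subseteq> A" for B
    proof -
      have fA: "finite A" using A AP by blast
      have fAB: "finite (A - B)" using fA by simp
      have irrAB: "\<And>p. p \<in> A - B \<Longrightarrow> irreducible p \<and> lead_coeff p = 1" using A(2)[OF AP] by blast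
      have "\<Prod>A = \<Prod>(A - B) * \<Prod>B"
        using BA fA by (rule prod.subset_diff)
      then have "\<Prod>A div \<Prod>B = \<Prod>(A - B)" using nz[OF BA] by simp
      moreover have "poly_norm (\<Prod>(A-B)) = (\<Prod>p\<in>A-B. poly_norm p)"
        using fAB irrAB irrAB[of 0] by (intro poly_norm_prod) auto
      moreover have "of_bool (\<Prod>(A-B) dvd r) = (\<Prod>p\<in>A-B. of_bool (p dvd r) :: complex)"
        using fAB irrAB by (rule of_bool_prod_monic_primes_dvd)
      ultimately show ?thesis by (simp add: prod.distrib)
    qed
    have primes: "monic_prime_factors (\<Prod>A) = A"
      using A[OF AP] by (rule monic_prime_factors_prod)
    have "?c (\<Prod>A) = (\<Sum>B\<in>Pow A. (- 1) ^ card B * (\<Prod>p\<in>A-B. poly_norm p * of_bool (p dvd r)))"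
      unfolding sum_poly_mu_monic_divisors[OF nz[OF subset_refl]] primes
      by (intro sum.cong refl) (simp add: factor)
    also have "\<dots> = (\<Prod>p\<in>A. poly_norm p * of_bool (p dvd r) - 1)"
      by (simp add: prod_diff_conv_sum[OF A(1)[OF AP]])
    finally have c: "?c (\<Prod>A) = (\<Prod>p\<in>A. poly_norm p * of_bool (p dvd r) - 1)" .
    have "of_nat (poly_phi (\<Prod>A)) = (\<Prod>p\<in>A. poly_norm p) * (\<Prod>p\<in>A. 1 - 1 / poly_norm p)"
    proof -
      have "poly_norm (\<Prod>A) = (\<Prod>p\<in>A. poly_norm p)"
        using A[OF AP] A(2)[OF AP, of 0] by (intro poly_norm_prod) auto
      then show ?thesis by (simp only: poly_phi_euler_product[OF nz[OF subset_refl]] primes)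
    qed
    also have "\<dots> = (\<Prod>p\<in>A. poly_norm p - 1)"
      by (simp add: right_diff_distrib flip: prod.distrib)
    finally show ?thesis by (simp add: c prod_dividef)
  qed
  have "(\<Sum>h\<in>monic_divisors f. of_int (poly_mu h) / of_nat (poly_phi h) * ?c h) =
      (\<Sum>h\<in>monic_divisors f. of_int (poly_mu h) * (?c h / of_nat (poly_phi h)))"
    by simp
  also have "\<dots> = (\<Prod>p\<in>?P. 1 - ?e p)"
    using f ratio by (rule mobius_euler_product)
  finally have sum: "(\<Sum>h\<in>monic_divisors f. of_int (poly_mu h) / of_nat (poly_phi h) * ?c h) =
    (\<Prod>p\<in>?P. 1 - ?e p)" .
  have "of_nat (poly_phi f) / poly_norm f * (\<Prod>p\<in>?P. 1 - ?e p) =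
      (\<Prod>p\<in>?P. (1 - 1 / poly_norm p) * (1 - ?e p))"
    using poly_phi_euler_product[OF f] by (simp add: prod.distrib)
  also have "\<dots> = (\<Prod>p\<in>?P. of_bool (\<not> p dvd r))"
  proof (intro prod.cong refl)
    fix p assume "p \<in> ?P"
    then show "(1 - 1 / poly_norm p) * (1 - ?e p) = of_bool (\<not> p dvd r)"
      using N1[of p] by (cases "p dvd r") (simp_all add: field_simps)
  qed
  also have "\<dots> = of_bool (\<forall>p\<in>?P. \<not> p dvd r)"
    using finP by (auto simp: of_bool_def)
  also have "(\<forall>p\<in>?P. \<not> p dvd r) \<longleftrightarrow> r = 1"
  proof
    assume no: "\<forall>p\<in>?P. \<not> p dvd r"
    have "is_unit r"
    proof (rule ccontr)
      assume "\<not> is_unit r"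
      then obtain p where "irreducible p" "lead_coeff p = 1" "p dvd r"
        using monic_prime_factor_exists[of r] r by fastforce
      then show False using no r by (auto simp: monic_prime_factors_def dest: dvd_trans)
    qed
    then show "r = 1" using r by (auto simp: is_unit_poly_iff)
  qed (auto simp: monic_prime_factors_def dest: irreducible_not_unit)
  finally show ?thesis by (simp only: sum)
qed

section \<open>Additive characters of a finite field\<close>

definition add_subgroup :: "'b::ab_group_add set \<Rightarrow> bool" where
  "add_subgroup W \<longleftrightarrow> 0 \<in> W \<and> (\<forall>x\<in>W. \<forall>y\<in>W. x - y \<in> W)"

lemma add_subgroup_closed:
  assumes "add_subgroup W"
  shows "0 \<in> W" "x \<in> W \<Longrightarrow> y \<in> W \<Longrightarrow> x - y \<in> W" "x \<in> W \<Longrightarrow> y \<in> W \<Longrightarrow> x + y \<in> W"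
proof -
  show 0: "0 \<in> W" and diff: "x \<in> W \<Longrightarrow> y \<in> W \<Longrightarrow> x - y \<in> W" for x y
    using assms by (auto simp: add_subgroup_def)
  show "x \<in> W \<Longrightarrow> y \<in> W \<Longrightarrow> x + y \<in> W"
    using diff[of x "0 - y"] diff[OF 0, of y] by simp
qed

lemma add_subgroup_of_int_mult:
  fixes W :: "'b::comm_ring_1 set"
  assumes "add_subgroup W" "x \<in> W"
  shows "of_int k * x \<in> W"
proof (induction k rule: int_induct[of _ 0])
  case (step1 i)
  then have "of_int i * x + x \<in> W" by (intro add_subgroup_closed(3)[OF assms(1) _ assms(2)])
  then show ?case by (simp add: distrib_right)
next
  case (step2 i)
  then have "of_int i * x - x \<in> W" by (intro add_subgroup_closed(2)[OF assms(1) _ assms(2)])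
  then show ?case by (simp add: left_diff_distrib)
qed (use add_subgroup_closed(1)[OF assms(1)] in simp)

text \<open>The prime field acts on subgroups, and its nonzero elements act invertibly.\<close>
lemma add_subgroup_of_int_cancel:
  fixes W :: "'b::finite_field set"
  assumes "add_subgroup W" "of_int k * x \<in> W" "\<not> int CHAR('b) dvd k"
  shows "x \<in> W"
proof -
  have "prime (int CHAR('b))" by simp
  then have "coprime (int CHAR('b)) k" using assms(3) by (rule prime_imp_coprime)
  then obtain u v where "u * int CHAR('b) + v * k = 1"
    using bezout_int[of "int CHAR('b)" k] by auto
  then have "of_int (u * int CHAR('b) + v * k) = (1 :: 'b)" by simp
  then have "of_int v * of_int k = (1 :: 'b)" by simp
  then have "x = of_int v * (of_int k * x)" by (simp flip: mult.assoc)
  then show ?thesis using add_subgroup_of_int_mult[OF assms(1,2), of v] by metis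
qed

lemma add_subgroup_adjoin:
  fixes H :: "'b::comm_ring_1 set"
  assumes H: "add_subgroup H"
  shows "add_subgroup {h + of_int j * x |h j. h \<in> H}"
  unfolding add_subgroup_def
proof (intro conjI ballI)
  let ?H' = "{h + of_int j * x |h j. h \<in> H}"
  have "(0::'b) = 0 + of_int 0 * x" by simp
  then show "0 \<in> ?H'" using add_subgroup_closed(1)[OF H] by blast
  fix y z assume "y \<in> ?H'" "z \<in> ?H'"
  then obtain h j h' j' where "y = h + of_int j * x" "z = h' + of_int j' * x" "h \<in> H" "h' \<in> H"
    by blast
  then have "y - z = (h - h') + of_int (j - j') * x" "h - h' \<in> H"
    using add_subgroup_closed(2)[OF H] by (auto simp: algebra_simps)
  then show "y - z \<in> ?H'" by blast
qed

text \<open>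
  A subgroup \<open>H\<close> that is maximal among those containing \<open>W\<close> but not \<open>\<alpha>\<close> is a hyperplane over the
  prime field, with complement spanned by \<open>\<alpha>\<close>.  Sending the \<open>\<alpha>\<close>-coordinate to a power of a
  primitive \<open>p\<close>-th root of unity gives the character.
\<close>
lemma separating_character:
  fixes W :: "'b::finite_field set"
  assumes W: "add_subgroup W" and \<alpha>: "\<alpha> \<notin> W"
  shows "\<exists>\<chi>. additive_character \<chi> \<and> (\<forall>w\<in>W. \<chi> w = 1) \<and> \<chi> \<alpha> \<noteq> 1"
proof -
  define p where "p = CHAR('b)"
  have p: "prime p" by (simp add: p_def)
  let ?Q = "\<lambda>H. add_subgroup H \<and> W \<subseteq> H \<and> \<alpha> \<notin> H"
  have "card H' < Suc CARD('b)" for H' :: "'b set"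
    by (simp add: less_Suc_eq_le card_mono)
  then obtain H where H: "?Q H" and max: "\<And>H'. ?Q H' \<Longrightarrow> card H' \<le> card H"
    using ex_has_greatest_nat[of ?Q W card "Suc CARD('b)"] W \<alpha> by blast
  note cl = add_subgroup_closed[of H]
  have sH: "add_subgroup H" and \<alpha>H: "\<alpha> \<notin> H" using H by auto
  \<comment> \<open>If \<open>x\<close> lies outside \<open>H\<close>, maximality puts \<open>\<alpha>\<close> into the subgroup generated by \<open>H\<close> and \<open>x\<close>.\<close>
  have coord: "\<exists>i::int. x - of_int i * \<alpha> \<in> H" for x
  proof (cases "x \<in> H")
    case False
    let ?H' = "{h + of_int j * x |h j. h \<in> H}"
    have "add_subgroup ?H'" using sH by (rule add_subgroup_adjoin)
    moreover have "H \<subset> ?H'"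
    proof -
      have "h = h + of_int 0 * x" for h by simp
      then have "H \<subseteq> ?H'" by blast
      moreover have "x = 0 + of_int 1 * x" by simp
      then have "x \<in> ?H'" using cl(1)[OF sH] by blast
      ultimately show ?thesis using False by blast
    qed
    moreover from this have "card H < card ?H'" by (intro psubset_card_mono) auto
    ultimately have "\<alpha> \<in> ?H'" using max[of ?H'] H by (meson not_le psubset_imp_subset subset_trans)
    then obtain h j where hj: "\<alpha> = h + of_int j * x" "h \<in> H" by blast
    have nd: "\<not> int p dvd j"
    proof
      assume "int p dvd j"
      then have "of_int j = (0::'b)" by (simp add: p_def of_int_eq_0_iff_char_dvd)
      then show False using hj \<alpha>H by simp
    qed
    moreover have "of_int j * x = - h + of_int 1 * \<alpha>" using hj by simp
    moreover have "- h \<in> H" using add_subgroup_closed(1)[OF sH] add_subgroup_closed(2)[OF sH, of 0 h] hj by simp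
    ultimately have jx: "of_int j * x \<in> {h + of_int i * \<alpha> |h i. h \<in> H}" by blast
    have "x \<in> {h + of_int i * \<alpha> |h i. h \<in> H}"
      using add_subgroup_of_int_cancel[OF add_subgroup_adjoin[OF sH] jx] nd by (simp add: p_def)
    then obtain h' i where "x = h' + of_int i * \<alpha>" "h' \<in> H" by blast
    then show ?thesis by (intro exI[of _ i]) simp
  qed (intro exI[of _ 0], simp)
  define e where "e = (\<lambda>i::int. cis (2 * pi * of_int i / of_nat p))"
  have e_add: "e (i + j) = e i * e j" for i j
    by (simp add: e_def cis_mult ring_distribs add_divide_distrib)
  have p0: "real p \<noteq> 0" using p by (simp add: prime_gt_0_nat)
  have e_period: "e i = e j" if "int p dvd i - j" for i j
  proof -
    obtain l where "i - j = int p * l" using \<open>int p dvd i - j\<close> by (elim dvdE)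
    then have "i = j + int p * l" by simp
    moreover have "e (int p * l) = 1"
      using p0 cis_multiple_2pi[of "of_int l"] by (simp add: e_def mult.assoc)
    ultimately show ?thesis by (simp add: e_add)
  qed
  \<comment> \<open>The \<open>\<alpha>\<close>-coordinate is determined only modulo \<open>p\<close>, the period of \<open>e\<close>.\<close>
  define \<chi> where "\<chi> = (\<lambda>x. e (SOME i. x - of_int i * \<alpha> \<in> H))"
  have \<chi>: "\<chi> x = e i" if i: "x - of_int i * \<alpha> \<in> H" for x i
  proof -
    define j where "j = (SOME i. x - of_int i * \<alpha> \<in> H)"
    have "x - of_int j * \<alpha> \<in> H" unfolding j_def using i by (rule someI)
    then have "(x - of_int i * \<alpha>) - (x - of_int j * \<alpha>) \<in> H" using cl(2)[OF sH] i by blast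
    then have "of_int (j - i) * \<alpha> \<in> H" by (simp add: algebra_simps)
    then have "int p dvd j - i" using add_subgroup_of_int_cancel[OF sH] \<alpha>H p_def by metis
    then show ?thesis by (simp add: \<chi>_def e_period flip: j_def)
  qed
  have "additive_character \<chi>"
    unfolding additive_character_def
  proof (intro conjI allI)
    fix x y
    obtain i j where ij: "x - of_int i * \<alpha> \<in> H" "y - of_int j * \<alpha> \<in> H" using coord by blast
    then have "(x - of_int i * \<alpha>) + (y - of_int j * \<alpha>) \<in> H" using cl(3)[OF sH] by blast
    then have "(x + y) - of_int (i + j) * \<alpha> \<in> H" by (simp add: algebra_simps)
    then show "\<chi> (x + y) = \<chi> x * \<chi> y" using ij by (simp only: \<chi> e_add)
  qed (simp add: \<chi>_def e_def)
  moreover have "\<chi> w = 1" if "w \<in> W" for w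
    using \<chi>[of w 0] that H by (auto simp: e_def)
  moreover have "\<chi> \<alpha> \<noteq> 1"
  proof
    assume "\<chi> \<alpha> = 1"
    moreover have "\<chi> \<alpha> = e 1" using cl(1)[OF sH] by (intro \<chi>) simp
    ultimately have "cos (2 * pi / p) = 1" by (simp add: e_def complex_eq_iff)
    then obtain l :: int where "2 * pi / p = of_int l * 2 * pi" by (auto simp: cos_one_2pi_int)
    then have "of_int (l * int p) = (1 :: real)" using p0 by (simp add: field_simps)
    then have "l * int p = 1" by linarith
    then have "int p dvd 1" by (metis dvd_triv_right)
    then show False using p by (simp add: prime_nat_iff)
  qed
  ultimately show ?thesis by blast
qed

lemma additive_character_simps:
  assumes "additive_character \<chi>"
  shows "\<chi> (x + y) = \<chi> x * \<chi> y" "\<chi> x \<noteq> 0" "\<chi> 0 = 1"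
proof -
  show 1: "\<chi> (x + y) = \<chi> x * \<chi> y" and 2: "\<chi> x \<noteq> 0" for x y
    using assms by (auto simp: additive_character_def)
  show "\<chi> 0 = 1" using 1[of 0 0] 2[of 0] by simp
qed

text \<open>All values are roots of unity of order dividing the characteristic.\<close>
lemma finite_additive_characters: "finite {\<chi> :: 'b::finite_field \<Rightarrow> complex. additive_character \<chi>}"
proof (rule finite_subset)
  let ?R = "{z::complex. z ^ CHAR('b) = 1}"
  show "{\<chi> :: 'b \<Rightarrow> complex. additive_character \<chi>} \<subseteq> PiE UNIV (\<lambda>_. ?R)"
  proof
    fix \<chi> :: "'b \<Rightarrow> complex" assume "\<chi> \<in> {\<chi>. additive_character \<chi>}"
    then have \<chi>: "additive_character \<chi>" by simp
    have "\<chi> (of_nat n * x) = \<chi> x ^ n" for n x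
      by (induction n) (simp_all add: additive_character_simps[OF \<chi>] ring_distribs)
    from this[of "CHAR('b)"] show "\<chi> \<in> PiE UNIV (\<lambda>_. ?R)"
      by (auto simp: additive_character_simps[OF \<chi>])
  qed
  show "finite (PiE (UNIV::'b set) (\<lambda>_. ?R))"
    by (intro finite_PiE finite_nth_roots) auto
qed

text \<open>Translation by \<open>a\<close> multiplies the sum by \<open>\<chi> a\<close>.\<close>
lemma sum_additive_character:
  fixes \<chi> :: "'b::finite_field \<Rightarrow> complex"
  assumes \<chi>: "additive_character \<chi>" and "\<chi> a \<noteq> 1"
  shows "(\<Sum>x\<in>UNIV. \<chi> x) = 0"
proof -
  have "(\<Sum>x\<in>UNIV. \<chi> x) = (\<Sum>x\<in>UNIV. \<chi> (a + x))"
    by (rule sum.reindex_bij_witness[of _ "\<lambda>x. a + x" "\<lambda>x. x - a"]) auto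
  also have "\<dots> = \<chi> a * (\<Sum>x\<in>UNIV. \<chi> x)"
    by (simp add: additive_character_simps[OF \<chi>] sum_distrib_left)
  finally show ?thesis using assms(2) by simp
qed

text \<open>
  Multiplication by a separating character permutes the characters trivial on \<open>W\<close>, so their sum
  vanishes outside \<open>W\<close>.  The number of these characters, which is the value inside \<open>W\<close>, comes from
  summing over all pairs of a character and a field element in both orders.
\<close>
lemma sum_characters_trivial_on:
  fixes W :: "'b::finite_field set"
  assumes W: "add_subgroup W"
  shows "(\<Sum>\<chi> | additive_character \<chi> \<and> (\<forall>w\<in>W. \<chi> w = 1). \<chi> \<alpha>) =
    of_nat CARD('b) / of_nat (card W) * of_bool (\<alpha> \<in> W)"
proof -
  let ?N = "{\<chi> :: 'b \<Rightarrow> complex. additive_character \<chi> \<and> (\<forall>w\<in>W. \<chi> w = 1)}"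
  have fin: "finite ?N"
    by (rule finite_subset[OF _ finite_additive_characters]) auto
  have outside: "(\<Sum>\<chi>\<in>?N. \<chi> x) = 0" if x: "x \<notin> W" for x
  proof -
    obtain \<psi> where \<psi>: "additive_character \<psi>" "\<forall>w\<in>W. \<psi> w = 1" "\<psi> x \<noteq> 1"
      using separating_character[OF W x] by blast
    note nz = additive_character_simps(2)[OF \<psi>(1)]
    have "(\<Sum>\<chi>\<in>?N. \<chi> x) = (\<Sum>\<chi>\<in>?N. \<psi> x * \<chi> x)"
      by (rule sum.reindex_bij_witness[of _ "\<lambda>\<chi> y. \<psi> y * \<chi> y" "\<lambda>\<chi> y. \<chi> y / \<psi> y"])
        (use \<psi> nz in \<open>auto simp: additive_character_def field_simps\<close>)
    also have "\<dots> = \<psi> x * (\<Sum>\<chi>\<in>?N. \<chi> x)" by (simp add: sum_distrib_left)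
    finally show ?thesis using \<psi>(3) by simp
  qed
  have inside: "(\<Sum>\<chi>\<in>?N. \<chi> x) = of_nat (card ?N)" if "x \<in> W" for x
    using that by simp
  have "of_nat (card W) * (of_nat (card ?N) :: complex) = (\<Sum>x\<in>W. \<Sum>\<chi>\<in>?N. \<chi> x)"
    using inside by simp
  also have "\<dots> = (\<Sum>x\<in>UNIV. \<Sum>\<chi>\<in>?N. \<chi> x)"
    using outside by (intro sum.mono_neutral_left) auto
  also have "\<dots> = (\<Sum>\<chi>\<in>?N. \<Sum>x\<in>UNIV. \<chi> x)" by (rule sum.swap)
  also have "\<dots> = (\<Sum>\<chi>\<in>{\<lambda>_. 1}. \<Sum>x\<in>(UNIV::'b set). \<chi> x)"
  proof (intro sum.mono_neutral_right ballI)
    show "{\<lambda>_. 1} \<subseteq> ?N" by (auto simp: additive_character_def)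
    fix \<chi> assume \<chi>: "\<chi> \<in> ?N - {\<lambda>_. 1}"
    then obtain a where "\<chi> a \<noteq> 1" by auto
    then show "(\<Sum>x\<in>UNIV. \<chi> x) = 0" using \<chi> by (intro sum_additive_character) auto
  qed (rule fin)
  finally have "of_nat (card W) * (of_nat (card ?N) :: complex) = of_nat CARD('b)" by simp
  moreover have "card W \<noteq> 0" using add_subgroup_closed(1)[OF W] by auto
  ultimately have "(of_nat (card ?N) :: complex) = of_nat CARD('b) / of_nat (card W)"
    by (simp add: field_simps)
  then show ?thesis using inside outside by (cases "\<alpha> \<in> W") simp_all
qed

section \<open>The action of polynomials through the Frobenius map\<close>

lemma monom_diff_1_monic:
  assumes "m \<ge> 1"
  shows "degree (monom 1 m - 1 :: 'a::field poly) = m" "lead_coeff (monom 1 m - 1 :: 'a poly) = 1"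
proof -
  show deg: "degree (monom 1 m - 1 :: 'a poly) = m"
    using assms by (subst diff_conv_add_uminus, subst degree_add_eq_left) (auto simp: degree_monom_eq)
  show "lead_coeff (monom 1 m - 1 :: 'a poly) = 1"
    using assms by (simp add: deg coeff_1)
qed

text \<open>
  A property closed under differences and multiples defines an ideal, which its least monic member
  generates.
\<close>
lemma is_least_monic_dvd_iff:
  fixes P :: "'a::field poly \<Rightarrow> bool"
  assumes f: "is_least_monic P f"
    and diff: "\<And>g h. P g \<Longrightarrow> P h \<Longrightarrow> P (g - h)"
    and mult: "\<And>g h. P g \<Longrightarrow> P (h * g)"
  shows "P e \<longleftrightarrow> f dvd e"
proof
  have Pf: "P f" and nz: "f \<noteq> 0" using f by (auto simp: is_least_monic_def)
  show "f dvd e \<Longrightarrow> P e" using mult[OF Pf] by (auto elim!: dvdE simp: mult.commute)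
  assume e: "P e"
  define r where "r = e mod f"
  have "r = e - (e div f) * f" by (simp add: r_def minus_div_mult_eq_mod)
  then have Pr: "P r" using diff e mult Pf by auto
  have "r = 0"
  proof (rule ccontr)
    assume r: "r \<noteq> 0"
    then have "degree r < degree f" using nz degree_mod_less'[of f e] by (simp add: r_def)
    moreover have "P (smult (inverse (lead_coeff r)) r)"
      using mult[OF Pr, of "[:inverse (lead_coeff r):]"] by simp
    then have "degree f \<le> degree (smult (inverse (lead_coeff r)) r)"
      using f r by (intro f[unfolded is_least_monic_def, THEN conjunct2, THEN conjunct2, rule_format]) auto
    ultimately show False using r by simp
  qed
  then show "f dvd e" by (simp add: r_def mod_eq_0_iff_dvd)
qed

text \<open>
  The polynomials \<open>x\<close> with \<open>h\<close> dividing \<open>d x\<close> form an ideal containing \<open>h\<close> and \<open>c\<close>.  Its generator is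
  a common divisor of these two, hence a unit, and so the ideal contains \<open>1\<close>.
\<close>
lemma poly_coprime_dvd_mult_left:
  fixes h :: "'a::field poly"
  assumes "coprime h c" "h dvd d * c" "h \<noteq> 0"
  shows "h dvd d"
proof -
  let ?P = "\<lambda>x. h dvd d * x"
  have diff: "?P (x - y)" if "?P x" "?P y" for x y using that by (simp add: right_diff_distrib)
  have mult: "?P (y * x)" if "?P x" for x y using that by (metis dvd_mult mult.left_commute)
  have "\<exists>!f. is_least_monic ?P f"
    using assms(3) by (intro is_least_monic_ex1 exI[of _ h]) (auto intro: diff dvd_smult)
  then obtain f where f: "is_least_monic ?P f" by blast
  note iff = is_least_monic_dvd_iff[OF f diff mult]
  have "f dvd h" "f dvd c" using iff[of h] iff[of c] assms(2) by simp_all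
  then have "is_unit f" using assms(1) by (rule coprime_common_divisor[rotated])
  then have "h dvd d * 1" using iff[of 1] by blast
  then show ?thesis by simp
qed

context
  fixes \<iota> :: "'a::finite_field \<Rightarrow> 'b::finite_field"
  assumes emb: "field_embedding \<iota>"
begin

text \<open>
  The polynomial \<open>(X + 1)^q - X^q - 1\<close> has degree less than \<open>q\<close> and vanishes on the whole small field,
  so it is zero: the inner binomial coefficients vanish in the small field, hence in the large one.
\<close>
lemma power_card_add: "(x + y :: 'b) ^ CARD('a) = x ^ CARD('a) + y ^ CARD('a)"
proof -
  define q where "q = CARD('a)"
  have q0: "0 < q" by (simp add: q_def)
  define D :: "'a poly" where "D = [:1, 1:] ^ q - monom 1 q - 1"
  have coeffD: "coeff D i = of_nat (q choose i)" if "0 < i" "i < q" for i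
    using that by (simp add: D_def coeff_linear_poly_power coeff_1)
  have root: "poly D c = 0" for c
    using finite_field_power_card_eq_same[of c] finite_field_power_card_eq_same[of "1 + c"]
    by (simp add: D_def poly_monom q_def algebra_simps)
  have "coeff D i = 0" if "i \<ge> q" for i
  proof (cases "i = q")
    case False
    then have "degree ([:1, 1:: 'a:] ^ q) < i" using that by (simp add: degree_power_eq)
    then show ?thesis using that q0 False by (simp add: D_def coeff_eq_0 coeff_1)
  qed (use q0 in \<open>simp add: D_def coeff_linear_poly_power coeff_1\<close>)
  then have "degree D < q \<or> D = 0"
    using leading_coeff_0_iff not_le by blast
  moreover have "q \<le> degree D" if "D \<noteq> 0"
    using card_poly_roots_bound[OF that] root by (simp add: q_def)
  ultimately have "D = 0" by linarith
  then have bin: "of_nat (q choose i) = (0 :: 'a)" if "0 < i" "i < q" for i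
    using coeffD[OF that] by simp
  have \<iota>nat: "\<iota> (of_nat n) = of_nat n" for n
    by (induction n) (simp_all add: embedding_simps[OF emb])
  have bin': "of_nat (q choose i) = (0 :: 'b)" if "0 < i" "i < q" for i
    using \<iota>nat[of "q choose i"] bin[OF that] by (simp add: embedding_simps[OF emb])
  have "(x + y) ^ q = (\<Sum>i\<le>q. of_nat (q choose i) * x ^ i * y ^ (q - i))"
    by (rule binomial_ring)
  also have "\<dots> = (\<Sum>i\<in>{0, q}. of_nat (q choose i) * x ^ i * y ^ (q - i))"
    using bin' by (intro sum.mono_neutral_right) auto
  also have "\<dots> = x ^ q + y ^ q" using q0 by simp
  finally show ?thesis by (simp add: q_def)
qed

lemma frob_act_pCons: "frob_act \<iota> (pCons a p) \<gamma> = \<iota> a * \<gamma> + frob_act \<iota> p (\<gamma> ^ CARD('a))"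
proof -
  have "frob_act \<iota> (pCons a p) \<gamma> =
      (\<Sum>i\<le>Suc (degree p). \<iota> (coeff (pCons a p) i) * \<gamma> ^ (CARD('a) ^ i))"
    using degree_pCons_le by (rule frob_act_eq_sum[OF emb])
  also have "\<dots> = \<iota> a * \<gamma> + (\<Sum>i\<le>degree p. \<iota> (coeff p i) * \<gamma> ^ (CARD('a) ^ Suc i))"
    by (subst sum.atMost_Suc_shift) simp
  finally show ?thesis by (simp add: frob_act_def power_mult)
qed

lemma frob_act_0 [simp]: "frob_act \<iota> 0 \<gamma> = 0"
  by (simp add: frob_act_def embedding_simps[OF emb])

lemma frob_act_plus: "frob_act \<iota> f (x + y) = frob_act \<iota> f x + frob_act \<iota> f y"
  by (induction f arbitrary: x y) (simp_all add: frob_act_pCons power_card_add algebra_simps)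

lemma frob_act_minus: "frob_act \<iota> f (x - y) = frob_act \<iota> f x - frob_act \<iota> f y"
  using frob_act_plus[of f "x - y" y] by simp

lemma frob_act_power_card: "frob_act \<iota> f (\<gamma> ^ CARD('a)) = frob_act \<iota> f \<gamma> ^ CARD('a)"
proof (induction f arbitrary: \<gamma>)
  case (pCons a p)
  have "\<iota> a ^ CARD('a) = \<iota> a"
    using finite_field_power_card_eq_same[of a] embedding_simps(6)[OF emb] by metis
  then show ?case
    by (simp add: frob_act_pCons power_card_add power_mult_distrib pCons.IH)
qed simp

lemma frob_act_add: "frob_act \<iota> (f + g) \<gamma> = frob_act \<iota> f \<gamma> + frob_act \<iota> g \<gamma>"
  using frob_act_diff[OF emb, of "f + g" g \<gamma>] by simp

text \<open>Composition is well behaved because the Frobenius map is additive and fixes the small field.\<close>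
lemma frob_act_mult: "frob_act \<iota> (f * g) \<gamma> = frob_act \<iota> f (frob_act \<iota> g \<gamma>)"
proof (induction f arbitrary: \<gamma>)
  case (pCons a f)
  have "frob_act \<iota> (pCons a f * g) \<gamma> =
      \<iota> a * frob_act \<iota> g \<gamma> + frob_act \<iota> (f * g) (\<gamma> ^ CARD('a))"
    by (simp add: mult_pCons_left frob_act_add frob_act_smult[OF emb] frob_act_pCons
        embedding_simps[OF emb])
  then show ?case by (simp add: pCons.IH frob_act_power_card frob_act_pCons)
qed simp

lemma frob_act_monom: "frob_act \<iota> (monom 1 m) \<gamma> = \<gamma> ^ (CARD('a) ^ m)"
proof (induction m arbitrary: \<gamma>)
  case 0
  then show ?case
    using frob_act_pCons[of 1 0 \<gamma>] by (simp add: embedding_simps[OF emb] one_pCons)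
next
  case (Suc m)
  then show ?case by (simp add: monom_Suc frob_act_pCons embedding_simps[OF emb] power_mult)
qed

lemma frob_act_monom_diff_1:
  assumes "CARD('b) = CARD('a) ^ m"
  shows "frob_act \<iota> (monom 1 m - 1) \<gamma> = 0"
  using frob_act_monom[of 0 \<gamma>] finite_field_power_card_eq_same[of \<gamma>] assms
  by (simp add: frob_act_diff[OF emb] frob_act_monom)

lemma elem_Order_dvd_iff: "elem_Order \<iota> \<gamma> dvd f \<longleftrightarrow> frob_act \<iota> f \<gamma> = 0"
  using is_least_monic_dvd_iff[OF elem_Order_welldefined[OF emb, of \<gamma>], of f]
    frob_act_minus[of _ 0 0]
  by (simp add: frob_act_diff[OF emb] frob_act_mult)

lemma char_Order_dvd_iff:
  assumes "additive_character \<chi>"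
  shows "char_Order \<iota> \<chi> dvd f \<longleftrightarrow> (\<forall>\<gamma>. \<chi> (frob_act \<iota> f \<gamma>) = 1)"
proof (rule is_least_monic_dvd_iff[OF char_Order_welldefined[OF emb assms], symmetric])
  note \<chi> = additive_character_simps[OF assms]
  fix g h assume g: "\<forall>\<gamma>. \<chi> (frob_act \<iota> g \<gamma>) = 1"
  show "\<forall>\<gamma>. \<chi> (frob_act \<iota> (h * g) \<gamma>) = 1"
    using g by (subst mult.commute) (simp add: frob_act_mult)
  assume h: "\<forall>\<gamma>. \<chi> (frob_act \<iota> h \<gamma>) = 1"
  show "\<forall>\<gamma>. \<chi> (frob_act \<iota> (g - h) \<gamma>) = 1"
  proof
    fix \<gamma> show "\<chi> (frob_act \<iota> (g - h) \<gamma>) = 1"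
      using \<chi>(1)[of "frob_act \<iota> (g - h) \<gamma>" "frob_act \<iota> h \<gamma>"] g h by (simp add: frob_act_diff[OF emb])
  qed
qed

text \<open>
  The kernel consists of the roots of the linearized polynomial attached to \<open>f\<close>, whose degree is
  \<open>q\<close> to the power \<open>degree f\<close>.
\<close>
lemma card_kernel_frob_act_le:
  assumes "f \<noteq> 0"
  shows "card {\<gamma>. frob_act \<iota> f \<gamma> = 0} \<le> CARD('a) ^ degree f"
proof -
  define L :: "'b poly" where "L = (\<Sum>i\<le>degree f. monom (\<iota> (coeff f i)) (CARD('a) ^ i))"
  have q: "1 < CARD('a)" by (rule card_field_gt_1)
  have "coeff L (CARD('a) ^ degree f) =
      (\<Sum>i\<le>degree f. if i = degree f then \<iota> (coeff f i) else 0)"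
    unfolding L_def coeff_sum coeff_monom using q
    by (intro sum.cong refl) (simp add: power_inject_exp)
  also have "\<dots> = \<iota> (lead_coeff f)" by simp
  also have "\<dots> \<noteq> 0"
  proof
    assume "\<iota> (lead_coeff f) = 0"
    moreover have "\<iota> (lead_coeff f) * \<iota> (inverse (lead_coeff f)) = 1"
      using assms by (simp flip: embedding_simps(2,3)[OF emb])
    ultimately show False by simp
  qed
  finally have "L \<noteq> 0" by auto
  have "degree L \<le> CARD('a) ^ degree f"
    unfolding L_def using q
    by (intro degree_sum_le) (auto intro!: order_trans[OF degree_monom_le] power_increasing)
  moreover have "{\<gamma>. frob_act \<iota> f \<gamma> = 0} = {\<gamma>. poly L \<gamma> = 0}"
    by (simp add: L_def frob_act_def poly_sum poly_monom)
  ultimately show ?thesis using card_poly_roots_bound[OF \<open>L \<noteq> 0\<close>] by simp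
qed

text \<open>The fibres of an additive map are translates of its kernel.\<close>
lemma card_kernel_times_range_frob_act:
  "card {\<gamma>. frob_act \<iota> f \<gamma> = 0} * card (range (frob_act \<iota> f)) = CARD('b)"
proof -
  let ?K = "{\<gamma>. frob_act \<iota> f \<gamma> = 0}"
  have "CARD('b) = (\<Sum>y\<in>range (frob_act \<iota> f). card {x \<in> UNIV. frob_act \<iota> f x = y})"
    using sum.image_gen[of "UNIV::'b set" "\<lambda>_. 1::nat" "frob_act \<iota> f"] by simp
  also have "\<dots> = (\<Sum>y\<in>range (frob_act \<iota> f). card ?K)"
  proof (intro sum.cong refl)
    fix y assume "y \<in> range (frob_act \<iota> f)"
    then obtain x0 where x0: "y = frob_act \<iota> f x0" by auto
    have "bij_betw (\<lambda>x. x - x0) {x \<in> UNIV. frob_act \<iota> f x = y} ?K"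
      by (rule bij_betwI[of _ _ _ "\<lambda>x. x + x0"]) (auto simp: x0 frob_act_minus frob_act_plus)
    then show "card {x \<in> UNIV. frob_act \<iota> f x = y} = card ?K" by (rule bij_betw_same_card)
  qed
  finally show ?thesis by simp
qed

text \<open>
  For complementary divisors \<open>d\<close> and \<open>e\<close> of \<open>x\<^sup>m - 1\<close>, the range of \<open>d\<close> lies in the kernel of \<open>e\<close>.
  The bounds on both kernels leave room only for equality.
\<close>
lemma range_frob_act_complementary:
  assumes card: "CARD('b) = CARD('a) ^ m" and de: "monom 1 m - 1 = d * e" and m: "m \<ge> 1"
  shows "range (frob_act \<iota> d) = {\<gamma>. frob_act \<iota> e \<gamma> = 0}"
    and "card (range (frob_act \<iota> d)) = CARD('a) ^ degree e"
proof -
  have deg: "degree (monom 1 m - 1 :: 'a poly) = m"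
    using m by (rule monom_diff_1_monic)
  then have nz: "d \<noteq> 0" "e \<noteq> 0" using de m by auto
  then have m': "m = degree d + degree e" using de deg by (simp add: degree_mult_eq)
  let ?I = "range (frob_act \<iota> d)" and ?Kd = "{\<gamma>. frob_act \<iota> d \<gamma> = 0}" and ?Ke = "{\<gamma>. frob_act \<iota> e \<gamma> = 0}"
  have sub: "?I \<subseteq> ?Ke"
    using frob_act_monom_diff_1[OF card] by (auto simp: de mult.commute simp flip: frob_act_mult)
  have "CARD('a) ^ degree d * CARD('a) ^ degree e = card ?Kd * card ?I"
    using card_kernel_times_range_frob_act[of d] card by (simp add: m' power_add)
  also have "\<dots> \<le> CARD('a) ^ degree d * card ?I"
    using card_kernel_frob_act_le[OF nz(1)] by (rule mult_right_mono) simp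
  finally have "CARD('a) ^ degree e \<le> card ?I" by simp
  moreover have "card ?I \<le> card ?Ke" using sub by (intro card_mono) auto
  moreover have "card ?Ke \<le> CARD('a) ^ degree e" using nz(2) by (rule card_kernel_frob_act_le)
  ultimately have "card ?I = card ?Ke" "card ?I = CARD('a) ^ degree e" by auto
  then show "?I = ?Ke" "card ?I = CARD('a) ^ degree e"
    using card_subset_eq[OF _ sub] by auto
qed

text \<open>
  The characters whose Order divides \<open>d\<close> are those trivial on the range of \<open>d\<close>, so orthogonality
  applies.
\<close>
lemma sum_characters_Order_dvd:
  assumes card: "CARD('b) = CARD('a) ^ m" and m: "m \<ge> 1" and d: "d dvd monom 1 m - 1"
  shows "(\<Sum>\<chi> | additive_character \<chi> \<and> char_Order \<iota> \<chi> dvd d. \<chi> \<alpha>) =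
    poly_norm d * of_bool (elem_Order \<iota> \<alpha> * d dvd monom 1 m - 1)"
proof -
  obtain e where de: "monom 1 m - 1 = d * e" using d by (elim dvdE)
  let ?I = "range (frob_act \<iota> d)"
  have deg: "degree (monom 1 m - 1 :: 'a poly) = m"
    using m by (rule monom_diff_1_monic)
  then have nz: "d \<noteq> 0" "e \<noteq> 0" using de m by auto
  then have m': "m = degree d + degree e" using de deg by (simp add: degree_mult_eq)
  have I: "add_subgroup ?I"
    unfolding add_subgroup_def
  proof (intro conjI ballI)
    show "0 \<in> ?I" using frob_act_minus[of d 0 0] by (metis diff_self rangeI)
    fix x y assume "x \<in> ?I" "y \<in> ?I"
    then show "x - y \<in> ?I" by (auto simp flip: frob_act_minus)
  qed
  have "{\<chi>. additive_character \<chi> \<and> char_Order \<iota> \<chi> dvd d} =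
      {\<chi>. additive_character \<chi> \<and> (\<forall>w\<in>?I. \<chi> w = 1)}"
    by (auto simp: char_Order_dvd_iff)
  then have "(\<Sum>\<chi> | additive_character \<chi> \<and> char_Order \<iota> \<chi> dvd d. \<chi> \<alpha>) =
      of_nat CARD('b) / of_nat (card ?I) * of_bool (\<alpha> \<in> ?I)"
    using sum_characters_trivial_on[OF I] by simp
  also have "of_nat CARD('b) / of_nat (card ?I) = poly_norm d"
    using range_frob_act_complementary(2)[OF card de m]
    by (simp add: card m' power_add poly_norm_def)
  also have "\<alpha> \<in> ?I \<longleftrightarrow> elem_Order \<iota> \<alpha> dvd e"
    using range_frob_act_complementary(1)[OF card de m] by (simp add: elem_Order_dvd_iff)
  also have "\<dots> \<longleftrightarrow> elem_Order \<iota> \<alpha> * d dvd monom 1 m - 1"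
    using nz by (simp add: de mult.commute)
  finally show ?thesis .
qed

text \<open>
  As \<open>g\<close> runs over the divisors of \<open>k\<close> with \<open>k / g\<close> coprime to \<open>h\<close>, the product \<open>h g\<close> runs over the
  divisors of \<open>h k\<close> with cofactor coprime to \<open>h\<close>.  Detecting the coprimality by a Moebius sum over
  \<open>t\<close> turns the condition on the Order into divisibility of \<open>h k / t\<close>.
\<close>
lemma sum_chars_of_Order_coprime:
  fixes h k :: "'a poly"
  assumes h: "lead_coeff h = 1" and k: "lead_coeff k = 1"
  shows "(\<Sum>g | g \<in> monic_divisors k \<and> coprime h (k div g). \<Sum>\<chi>\<in>chars_of_Order \<iota> (h * g). \<chi> \<alpha>) =
    (\<Sum>t\<in>monic_divisors h. of_int (poly_mu t) *
      (\<Sum>\<chi> | additive_character \<chi> \<and> char_Order \<iota> \<chi> dvd h div t * k. \<chi> \<alpha>))"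
proof -
  let ?C = "{\<chi> :: 'b \<Rightarrow> complex. additive_character \<chi>}"
  let ?o = "char_Order \<iota>"
  let ?G = "{g. g \<in> monic_divisors k \<and> coprime h (k div g)}"
  have nz: "h \<noteq> 0" "k \<noteq> 0" using h k by auto
  have finC: "finite ?C" by (rule finite_additive_characters)
  have finG: "finite ?G" using finite_monic_divisors[OF nz(2)] by simp
  have o_monic: "lead_coeff (?o \<chi>) = 1" if "\<chi> \<in> ?C" for \<chi>
    using char_Order_welldefined[OF emb, of \<chi>] that by (auto simp: is_least_monic_def)
  let ?X = "{\<chi>\<in>?C. ?o \<chi> dvd h * k \<and> coprime h ((h * k) div ?o \<chi>)}"
  have "(\<Union>g\<in>?G. chars_of_Order \<iota> (h * g)) = ?X"
  proof (intro equalityI subsetI)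
    fix \<chi> assume "\<chi> \<in> (\<Union>g\<in>?G. chars_of_Order \<iota> (h * g))"
    then obtain g where g: "g dvd k" "coprime h (k div g)" and \<chi>: "additive_character \<chi>" "?o \<chi> = h * g"
      by (auto simp: monic_divisors_def chars_of_Order_def)
    then show "\<chi> \<in> ?X" using nz by (simp add: mult_dvd_mono)
  next
    fix \<chi> assume "\<chi> \<in> ?X"
    then have \<chi>: "\<chi> \<in> ?C" "?o \<chi> dvd h * k" "coprime h ((h * k) div ?o \<chi>)" by auto
    then obtain c where c: "h * k = ?o \<chi> * c" by (elim dvdE)
    have o0: "?o \<chi> \<noteq> 0" using o_monic[OF \<chi>(1)] by auto
    then have "coprime h c" using \<chi>(3) c by simp
    moreover have "h dvd ?o \<chi> * c" by (simp flip: c)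
    ultimately have "h dvd ?o \<chi>" using nz(1) by (rule poly_coprime_dvd_mult_left)
    then obtain g where g: "?o \<chi> = h * g" by (elim dvdE)
    then have "k = g * c" using c nz by (simp add: mult.assoc)
    moreover have "lead_coeff g = 1" using o_monic[OF \<chi>(1)] h by (simp add: g lead_coeff_mult)
    moreover have "g \<noteq> 0" using g o0 by auto
    ultimately have "g \<in> ?G" using \<open>coprime h c\<close> by (simp add: monic_divisors_def)
    then show "\<chi> \<in> (\<Union>g\<in>?G. chars_of_Order \<iota> (h * g))"
      using \<chi>(1) g by (auto simp: chars_of_Order_def)
  qed
  then have "(\<Sum>g\<in>?G. \<Sum>\<chi>\<in>chars_of_Order \<iota> (h * g). \<chi> \<alpha>) = (\<Sum>\<chi>\<in>?X. \<chi> \<alpha>)"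
    using finG nz finC
    by (subst sum.UNION_disjoint[symmetric]) (auto simp: chars_of_Order_def)
  also have "\<dots> = (\<Sum>\<chi>\<in>?C. \<chi> \<alpha> * (of_bool (?o \<chi> dvd h * k) * of_bool (coprime h ((h * k) div ?o \<chi>))))"
    using finC by (intro sum.mono_neutral_cong_left) auto
  also have "\<dots> = (\<Sum>\<chi>\<in>?C. \<Sum>t\<in>monic_divisors h. of_int (poly_mu t) *
      (\<chi> \<alpha> * of_bool (?o \<chi> dvd h div t * k)))"
  proof (intro sum.cong refl)
    fix \<chi> assume \<chi>: "\<chi> \<in> ?C"
    have o0: "?o \<chi> \<noteq> 0" using o_monic[OF \<chi>] by auto
    have "of_bool (?o \<chi> dvd h * k) * (of_bool (t dvd (h * k) div ?o \<chi>) :: complex) =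
        of_bool (?o \<chi> dvd h div t * k)" if t: "t \<in> monic_divisors h" for t
    proof -
      obtain s where s: "h = t * s" using t by (auto simp: monic_divisors_def elim: dvdE)
      have t0: "t \<noteq> 0" using t by (auto simp: monic_divisors_def)
      have "?o \<chi> dvd h * k \<and> t dvd (h * k) div ?o \<chi> \<longleftrightarrow> t * ?o \<chi> dvd t * (s * k)"
        using o0 by (auto simp: s dvd_div_iff_mult mult.assoc dest: dvd_mult_right)
      also have "\<dots> \<longleftrightarrow> ?o \<chi> dvd s * k" using t0 by simp
      finally show ?thesis using t0 by (auto simp: s)
    qed
    then show "\<chi> \<alpha> * (of_bool (?o \<chi> dvd h * k) * of_bool (coprime h ((h * k) div ?o \<chi>))) =
        (\<Sum>t\<in>monic_divisors h. of_int (poly_mu t) * (\<chi> \<alpha> * of_bool (?o \<chi> dvd h div t * k)))"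
      unfolding coprime_indicator[OF nz(1), symmetric] sum_distrib_left
      by (intro sum.cong refl) (simp add: mult_ac)
  qed
  also have "\<dots> = (\<Sum>t\<in>monic_divisors h. of_int (poly_mu t) *
      (\<Sum>\<chi>\<in>?C. \<chi> \<alpha> * of_bool (?o \<chi> dvd h div t * k)))"
    by (subst sum.swap) (simp only: sum_distrib_left)
  also have "\<dots> = (\<Sum>t\<in>monic_divisors h. of_int (poly_mu t) *
      (\<Sum>\<chi> | additive_character \<chi> \<and> ?o \<chi> dvd h div t * k. \<chi> \<alpha>))"
  proof -
    have "(\<Sum>\<chi>\<in>?C. \<chi> \<alpha> * of_bool (?o \<chi> dvd h div t * k)) =
        (\<Sum>\<chi> | additive_character \<chi> \<and> ?o \<chi> dvd h div t * k. \<chi> \<alpha>)" for t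
      using finC by (intro sum.mono_neutral_cong_right) auto
    then show ?thesis by simp
  qed
  finally show ?thesis .
qed

end

section \<open>The indicator of a given Order\<close>

theorem theorem4p3:
  fixes \<iota> :: "'a::finite_field \<Rightarrow> 'b::finite_field"
    and q m n :: nat
    and f :: "'a poly"
    and \<alpha> :: 'b
  assumes "CARD('a) = q"
    and "m \<ge> 1"
    and "CARD('b) = q ^ m"
    and "field_embedding \<iota>"
    and "lead_coeff f = 1"
    and "f dvd monom 1 m - 1"
    and "degree f = n"
  shows "eta \<iota> f \<alpha> =
    of_nat (poly_phi f) / of_nat (q ^ m) *
    (\<Sum>h\<in>monic_divisors f. of_int (poly_mu h) / of_nat (poly_phi h) *
      (\<Sum>g | g \<in> monic_divisors ((monom 1 m - 1) div f) \<and>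
              coprime h ((monom 1 m - 1) div (f * g)).
        \<Sum>\<chi>\<in>chars_of_Order \<iota> (h * g). \<chi> \<alpha>))"
proof -
  note emb = assms(4)
  have card: "CARD('b) = CARD('a) ^ m" using assms by simp
  define F :: "'a poly" where "F = monom 1 m - 1"
  obtain k where Fk: "F = f * k" using assms(6) by (auto simp: F_def elim: dvdE)
  have F: "degree F = m" "lead_coeff F = 1" unfolding F_def by (rule monom_diff_1_monic[OF assms(2)])+
  have k1: "lead_coeff k = 1" using F(2) assms(5) by (simp add: Fk lead_coeff_mult)
  have nz: "f \<noteq> 0" "k \<noteq> 0" using assms(5) k1 by auto
  define a where "a = elem_Order \<iota> \<alpha>"
  have a1: "lead_coeff a = 1"
    using elem_Order_welldefined[OF emb, of \<alpha>] by (simp add: a_def is_least_monic_def)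
  then have a0: "a \<noteq> 0" by auto
  \<comment> \<open>With \<open>s = h / t\<close>, the condition \<open>a s k dvd f k\<close> from orthogonality loses the common factor \<open>k\<close>.\<close>
  have inner: "(\<Sum>g | g \<in> monic_divisors (F div f) \<and> coprime h (F div (f * g)).
        \<Sum>\<chi>\<in>chars_of_Order \<iota> (h * g). \<chi> \<alpha>) =
      poly_norm k * (\<Sum>t\<in>monic_divisors h. of_int (poly_mu t) *
        (poly_norm (h div t) * of_bool (a * (h div t) dvd f)))"
    if h: "h \<in> monic_divisors f" for h
  proof -
    have "F div (f * g) = k div g" for g using nz by (simp add: Fk)
    moreover have "F div f = k" using nz by (simp add: Fk)
    moreover have h1: "lead_coeff h = 1" using h by (simp add: monic_divisors_def)
    ultimately have "(\<Sum>g | g \<in> monic_divisors (F div f) \<and> coprime h (F div (f * g)).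
        \<Sum>\<chi>\<in>chars_of_Order \<iota> (h * g). \<chi> \<alpha>) = (\<Sum>t\<in>monic_divisors h. of_int (poly_mu t) *
      (\<Sum>\<chi> | additive_character \<chi> \<and> char_Order \<iota> \<chi> dvd h div t * k. \<chi> \<alpha>))"
      using sum_chars_of_Order_coprime[OF emb h1 k1, of \<alpha>] by simp
    also have "\<dots> = (\<Sum>t\<in>monic_divisors h. of_int (poly_mu t) *
        (poly_norm k * (poly_norm (h div t) * of_bool (a * (h div t) dvd f))))"
    proof (intro sum.cong refl arg_cong2[where f = "(*)"])
      fix t assume "t \<in> monic_divisors h"
      then have t: "t dvd h" "t \<noteq> 0" by (auto simp: monic_divisors_def)
      then obtain s where s: "h = t * s" by (elim dvdE)
      then have hs: "h div t = s" "s \<noteq> 0" using h1 t by auto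
      have "s dvd f" using h s by (auto simp: monic_divisors_def dest: dvd_mult_right)
      then have "s * k dvd monom 1 m - 1" by (simp add: Fk mult_dvd_mono flip: F_def)
      then have "(\<Sum>\<chi> | additive_character \<chi> \<and> char_Order \<iota> \<chi> dvd s * k. \<chi> \<alpha>) =
          poly_norm (s * k) * of_bool (a * (s * k) dvd f * k)"
        using sum_characters_Order_dvd[OF emb card assms(2), of "s * k" \<alpha>]
        by (simp add: a_def Fk flip: F_def)
      also have "a * (s * k) dvd f * k \<longleftrightarrow> a * s dvd f"
        using nz by (simp flip: mult.assoc)
      finally show "(\<Sum>\<chi> | additive_character \<chi> \<and> char_Order \<iota> \<chi> dvd h div t * k. \<chi> \<alpha>) =
          poly_norm k * (poly_norm (h div t) * of_bool (a * (h div t) dvd f))"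
        using hs nz by (simp add: poly_norm_mult)
    qed
    finally show ?thesis by (simp add: sum_distrib_left mult_ac)
  qed
  have norm: "of_nat (q ^ m) = poly_norm f * poly_norm k"
  proof -
    have "m = degree f + degree k" using F(1) nz by (simp add: Fk degree_mult_eq)
    then show ?thesis by (simp add: poly_norm_def power_add assms(1))
  qed
  have "of_nat (poly_phi f) / of_nat (q ^ m) *
      (\<Sum>h\<in>monic_divisors f. of_int (poly_mu h) / of_nat (poly_phi h) *
        (\<Sum>g | g \<in> monic_divisors (F div f) \<and> coprime h (F div (f * g)).
          \<Sum>\<chi>\<in>chars_of_Order \<iota> (h * g). \<chi> \<alpha>)) =
    of_nat (poly_phi f) / (poly_norm f * poly_norm k) *
      (\<Sum>h\<in>monic_divisors f. poly_norm k * (of_int (poly_mu h) / of_nat (poly_phi h) *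
        (\<Sum>t\<in>monic_divisors h. of_int (poly_mu t) *
          (poly_norm (h div t) * of_bool (a * (h div t) dvd f)))))"
  proof -
    have "(\<Sum>h\<in>monic_divisors f. of_int (poly_mu h) / of_nat (poly_phi h) *
          (\<Sum>g | g \<in> monic_divisors (F div f) \<and> coprime h (F div (f * g)).
            \<Sum>\<chi>\<in>chars_of_Order \<iota> (h * g). \<chi> \<alpha>)) =
        (\<Sum>h\<in>monic_divisors f. poly_norm k * (of_int (poly_mu h) / of_nat (poly_phi h) *
          (\<Sum>t\<in>monic_divisors h. of_int (poly_mu t) *
            (poly_norm (h div t) * of_bool (a * (h div t) dvd f)))))"
    proof (rule sum.cong[OF refl])
      fix h assume "h \<in> monic_divisors f"
      then show "of_int (poly_mu h) / of_nat (poly_phi h) *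
          (\<Sum>g | g \<in> monic_divisors (F div f) \<and> coprime h (F div (f * g)).
            \<Sum>\<chi>\<in>chars_of_Order \<iota> (h * g). \<chi> \<alpha>) =
        poly_norm k * (of_int (poly_mu h) / of_nat (poly_phi h) *
          (\<Sum>t\<in>monic_divisors h. of_int (poly_mu t) *
            (poly_norm (h div t) * of_bool (a * (h div t) dvd f))))"
        by (simp only: inner) (simp only: mult_ac)
    qed
    then show ?thesis by (simp only: norm)
  qed
  also have "\<dots> = of_nat (poly_phi f) / poly_norm f *
      (\<Sum>h\<in>monic_divisors f. of_int (poly_mu h) / of_nat (poly_phi h) *
        (\<Sum>t\<in>monic_divisors h. of_int (poly_mu t) *
          (poly_norm (h div t) * of_bool (a * (h div t) dvd f))))"
    by (simp only: sum_distrib_left[symmetric]) simp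
  also have "\<dots> = of_bool (a = f)"
  proof (cases "a dvd f")
    case True
    then obtain r where r: "f = a * r" by (elim dvdE)
    have "lead_coeff r = 1" using a1 assms(5) by (simp add: r lead_coeff_mult)
    moreover have "a * s dvd f \<longleftrightarrow> s dvd r" for s using a0 by (simp add: r)
    moreover have "a = f \<longleftrightarrow> r = 1" using a0 by (auto simp: r)
    ultimately show ?thesis using sum_ramanujan_eq_indicator[OF nz(1), of r] by (simp add: r)
  next
    case False
    then have "\<not> a * s dvd f" for s using dvd_mult_left by blast
    then show ?thesis using False by auto
  qed
  finally show ?thesis by (simp add: eta_def a_def of_bool_def flip: F_def)
qed

end
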